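(* Let $\mathcal{F}=\mathcal{D}+\mathcal{R}$ be the cost function on $\mathbb{R}^N$ defined in the context, with nonconvex data-fidelity term $\mathcal{D}(\mathbf{f})=\frac12\|\mathbf{y}-\mathcal{Z}(\mathbf{f})\|_2^2$ and convex regularizer $\mathcal{R}(\mathbf{f})=\tau\sum_{n=1}^N\sqrt{\sum_{d=1}^2|[\mathbf{D}_d\mathbf{f}]_n|^2}+\chi_{\mathcal{C}}(\mathbf{f})$. Fix $\alpha\in[0,1)$ and $\mathbf{f}_0\in\mathbb{R}^N$, and let $\{\mathbf{f}_k\}_{k\ge0}$, $\{\mathbf{s}_k\}_{k\ge1}$ be the iterates of relaxed FISTA with step-size $\gamma$: $\mathbf{s}_1=\mathbf{f}_0$, $t_0=1$, $t_{k+1}=\frac{\sqrt{4t_k^2+1}+1}{2}$ for $k\ge0$, and for $k\ge1$ $$\mathbf{f}_k=\mathrm{prox}_{\gamma\mathcal{R}}\left(\mathbf{s}_k-\gamma\nabla\mathcal{D}(\mathbf{s}_k)\right),\qquad \mathbf{s}_{k+1}=\mathbf{f}_k+\alpha\left(\frac{t_k-1}{t_{k+1}}\right)(\mathbf{f}_k-\mathbf{f}_{k-1}).$$ Let $\mathcal{U}\subset\mathbb{R}^N$ be a bounded set that covers all possible values for $\{\mathbf{f}_k\}_{k\ge0}$ and $\{\mathbf{s}_k\}_{k\ge1}$ (in the sense made precise in the context), assume that $\|\mathbf{u}^{\mathrm{in}}\|<\infty$ and that $\mathbf{A}(\mathbf{s})=\mathbf{I}-\mathbf{G}\,\mathrm{diag}(\mathbf{s})$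 is non-singular for all $\mathbf{s}\in\mathcal{U}$, and let $L\in(0,\infty)$ be a corresponding Lipschitz constant, i.e. $\|\nabla\mathcal{D}(\mathbf{s}_1)-\nabla\mathcal{D}(\mathbf{s}_2)\|\le L\|\mathbf{s}_1-\mathbf{s}_2\|$ for all $\mathbf{s}_1,\mathbf{s}_2\in\mathcal{U}$. Choose $0<\gamma\le\frac{1-\alpha^2}{2L}$. Define the gradient mapping $$\mathcal{G}_\gamma(\mathbf{f}):=\frac{\mathbf{f}-\mathrm{prox}_{\gamma\mathcal{R}}\left(\mathbf{f}-\gamma\nabla\mathcal{D}(\mathbf{f})\right)}{\gamma}.$$ Then relaxed FISTA achieves the stationary points of $\mathcal{F}$ in the sense that $$\lim_{k\to\infty}\|\mathcal{G}_\gamma(\mathbf{f}_k)\|=0.$$ Moreover, let $\mathcal{F}^*$ denote the global minimum of $\mathcal{F}$, assumed to exist. Then for any integer $K>0$, $$\min_{k\in\{1,\ldots,K\}}\|\mathcal{G}_\gamma(\mathbf{f}_k)\|^2\le\frac{2L(3+\gamma L)^2\left(\mathcal{F}(\mathbf{f}_0)-\mathcal{F}^*\right)}{K\gamma L(1-\gamma L)}.$$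
   Context: Fixed data: $\mathbf{H}\in\mathbb{C}^{M\times N}$, $\mathbf{G}\in\mathbb{C}^{N\times N}$ (discretizations of the free-space Green's function), $\mathbf{u}^{\mathrm{in}}\in\mathbb{C}^N$, $\mathbf{y}\in\mathbb{C}^M$, $\tau>0$. $\mathrm{diag}(\mathbf{a})$ is the diagonal matrix with $\mathbf{a}$ on its diagonal and $\|\cdot\|$ is the Euclidean norm. For $\mathbf{f}\in\mathbb{R}^N$ with $\mathbf{A}(\mathbf{f}):=\mathbf{I}-\mathbf{G}\,\mathrm{diag}(\mathbf{f})$ non-singular, $\mathbf{u}(\mathbf{f}):=\mathbf{A}(\mathbf{f})^{-1}\mathbf{u}^{\mathrm{in}}$, $\mathcal{Z}(\mathbf{f}):=\mathbf{H}\,\mathrm{diag}(\mathbf{u}(\mathbf{f}))\,\mathbf{f}$, and $\mathcal{D}(\mathbf{f}):=\frac12\|\mathbf{y}-\mathcal{Z}(\mathbf{f})\|_2^2$; $\nabla\mathcal{D}(\mathbf{f})\in\mathbb{R}^N$ is the gradient with respect to the real vector $\mathbf{f}$, which exists at such $\mathbf{f}$. $\mathbf{D}_1,\mathbf{D}_2$ are real linear operators $\mathbb{R}^N\to\mathbb{R}^N$ (discrete gradient operators in the two dimensions). $\mathcal{C}\subset\mathbb{R}^N$ is a nonempty, bounded, closed, convex set, and $\chi_{\mathcal{C}}(\mathbf{f})=0$ if $\mathbf{f}\in\mathcal{C}$, $+\infty$ otherwise. $\mathcal{F}(\mathbf{f}):=\mathcal{D}(\mathbf{f})+\mathcal{R}(\mathbf{f})$,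 which equals $+\infty$ for $\mathbf{f}\notin\mathcal{C}$. The gradient mapping $\mathcal{G}_\gamma(\mathbf{f})$ is considered at points where $\nabla\mathcal{D}(\mathbf{f})$ exists. The proximal operator is $\mathrm{prox}_{\gamma\mathcal{R}}(\mathbf{z}):=\arg\min_{\mathbf{x}\in\mathbb{R}^N}\left\{\frac12\|\mathbf{x}-\mathbf{z}\|^2+\gamma\mathcal{R}(\mathbf{x})\right\}$; its values lie in $\mathcal{C}$. "$\mathcal{U}$ covers all possible values of the iterates" means: since $\mathbf{f}_k\in\mathcal{C}$ for $k\ge1$ and $\mathbf{s}_{k+1}=\mathbf{f}_k+\beta_k(\mathbf{f}_k-\mathbf{f}_{k-1})$ with $\beta_k=\alpha\frac{t_k-1}{t_{k+1}}\in[0,1)$, the set $\mathcal{U}$ contains every point of the form $\mathbf{x}+\beta(\mathbf{x}-\mathbf{x}')$ with $\mathbf{x},\mathbf{x}'\in\mathcal{C}\cup\{\mathbf{f}_0\}$ and $\beta\in[0,1)$ (in particular $\mathcal{C}\cup\{\mathbf{f}_0\}\subset\mathcal{U}$). *)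

theory Defs
  imports "HOL-Analysis.Analysis"
begin

definition diag :: "'a::zero ^ 'n \<Rightarrow> 'a ^ 'n ^ 'n"
  where "diag a = (\<chi> i j. if i = j then a $ i else 0)"

definition cvec :: "real ^ 'n \<Rightarrow> complex ^ 'n"
  where "cvec f = (\<chi> i. complex_of_real (f $ i))"

definition scat_matrix :: "complex ^ 'n ^ 'n \<Rightarrow> real ^ 'n \<Rightarrow> complex ^ 'n ^ 'n"
  where "scat_matrix G f = mat 1 - G ** diag (cvec f)"

text \<open>If \<open>scat_matrix G f\<close> is singular, the following three values are arbitrary but well typed;
  they are meaningful only where \<open>invertible (scat_matrix G f)\<close> holds.\<close>

definition total_field :: "complex ^ 'n ^ 'n \<Rightarrow> complex ^ 'n \<Rightarrow> real ^ 'n \<Rightarrow> complex ^ 'n"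
  where "total_field G uin f = matrix_inv (scat_matrix G f) *v uin"

definition forward_model ::
    "complex ^ 'n ^ 'm \<Rightarrow> complex ^ 'n ^ 'n \<Rightarrow> complex ^ 'n \<Rightarrow> real ^ 'n \<Rightarrow> complex ^ 'm"
  where "forward_model H G uin f = (H ** diag (total_field G uin f)) *v cvec f"

definition data_fidelity ::
    "complex ^ 'n ^ 'm \<Rightarrow> complex ^ 'n ^ 'n \<Rightarrow> complex ^ 'n \<Rightarrow> complex ^ 'm \<Rightarrow> real ^ 'n \<Rightarrow> real"
  where "data_fidelity H G uin y f = 1 / 2 * (norm (y - forward_model H G uin f))\<^sup>2"

definition gradient :: "('a::real_inner \<Rightarrow> real) \<Rightarrow> 'a \<Rightarrow> 'a"
  where "gradient \<phi> x = (THE g. GDERIV \<phi> x :> g)"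

definition set_chi :: "'a set \<Rightarrow> 'a \<Rightarrow> ereal"
  where "set_chi C x = (if x \<in> C then 0 else \<infinity>)"

definition regularizer ::
    "real \<Rightarrow> (nat \<Rightarrow> real ^ 'n \<Rightarrow> real ^ 'n) \<Rightarrow> (real ^ 'n) set \<Rightarrow> real ^ 'n \<Rightarrow> ereal"
  where "regularizer \<tau> D C f =
    ereal (\<tau> * (\<Sum>n\<in>UNIV. sqrt (\<Sum>d\<in>{1..2}. \<bar>D d f $ n\<bar>\<^sup>2))) + set_chi C f"

definition prox :: "real \<Rightarrow> ('a::real_normed_vector \<Rightarrow> ereal) \<Rightarrow> 'a \<Rightarrow> 'a"
  where "prox \<gamma> R z =
    arg_min (\<lambda>x. ereal (1 / 2 * (norm (x - z))\<^sup>2) + ereal \<gamma> * R x) (\<lambda>_. True)"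

definition gradient_mapping ::
    "real \<Rightarrow> ('a::real_inner \<Rightarrow> real) \<Rightarrow> ('a \<Rightarrow> ereal) \<Rightarrow> 'a \<Rightarrow> 'a"
  where "gradient_mapping \<gamma> \<phi> R f =
    (f - prox \<gamma> R (f - \<gamma> *\<^sub>R gradient \<phi> f)) /\<^sub>R \<gamma>"

end

theory Submission
  imports Defs
begin

text \<open>Write \<open>r\<close> for the total variation term and \<open>P\<close> for the proximal operator. The two-sided
  quadratic bounds for \<open>\<D>\<close> at \<open>s\<^sub>k\<close>, together with the optimality condition of \<open>P\<close> tested at
  \<open>f\<^sub>k\<^sub>-\<^sub>1\<close>, show that the energy \<open>\<D> f\<^sub>k + r f\<^sub>k + \<parallel>f\<^sub>k - f\<^sub>k\<^sub>-\<^sub>1\<parallel>\<^sup>2 / (2\<gamma>)\<close> drops by at least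
  \<open>(1 - \<gamma> L) / (2\<gamma>) \<cdot> \<parallel>f\<^sub>k - s\<^sub>k\<parallel>\<^sup>2\<close>; the step size bound enters as \<open>(1 + \<gamma> L) \<alpha>\<^sup>2 \<le> 1\<close>. Hence the
  residuals \<open>\<parallel>f\<^sub>k - s\<^sub>k\<parallel>\<^sup>2\<close> are summable, and since \<open>P\<close> is nonexpansive they dominate the gradient
  mapping at \<open>f\<^sub>k\<close>. The bounds need the segments from \<open>s\<^sub>k\<close> to \<open>f\<^sub>k\<close> and \<open>f\<^sub>k\<^sub>-\<^sub>1\<close> to lie in \<open>U\<close>, which
  is clear only if \<open>f\<^sub>k\<^sub>-\<^sub>1\<close> and \<open>f\<^sub>k\<^sub>-\<^sub>2\<close> belong to \<open>C\<close>. If \<open>f\<^sub>0 \<notin> C\<close> this holds for \<open>k \<ge> 3\<close>, which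
  suffices for the limit, whereas the rate is trivial because \<open>\<F> f\<^sub>0 = \<infinity>\<close>.\<close>

section \<open>Differentiability of the data fidelity\<close>

text \<open>The Riesz representative of the derivative is its adjoint at 1. Uniqueness of
  derivatives makes the \<open>THE\<close> in \<open>gradient\<close> pick it.\<close>

lemma differentiable_imp_GDERIV_gradient:
  fixes \<phi> :: "'a::euclidean_space \<Rightarrow> real"
  assumes "\<phi> differentiable (at x)"
  shows "GDERIV \<phi> x :> gradient \<phi> x"
proof -
  obtain \<phi>' where \<phi>': "(\<phi> has_derivative \<phi>') (at x)"
    using assms by (auto simp: differentiable_def)
  then have "linear \<phi>'"
    by (rule has_derivative_linear)
  define e where "e = adjoint \<phi>' 1"
  have "\<phi>' h = h \<bullet> e" for h
    using adjoint_works[OF \<open>linear \<phi>'\<close>, of h 1] by (simp add: e_def)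
  then have "\<phi>' = (\<lambda>h. h \<bullet> e)" by (rule ext)
  with \<phi>' have *: "GDERIV \<phi> x :> e" by (simp add: gderiv_def)
  have "e' = e" if "GDERIV \<phi> x :> e'" for e'
  proof -
    have "(\<lambda>h. h \<bullet> e') = (\<lambda>h. h \<bullet> e)"
      using that * unfolding gderiv_def by (rule has_derivative_unique)
    then show ?thesis by (simp add: fun_eq_iff vector_eq_ldot)
  qed
  with * show ?thesis unfolding gradient_def by (rule theI[of "\<lambda>g. GDERIV \<phi> x :> g"])
qed

lemma differentiable_prod:
  fixes F :: "'i \<Rightarrow> 'a::real_normed_vector \<Rightarrow> 'b::real_normed_field"
  assumes "\<And>i. i \<in> I \<Longrightarrow> F i differentiable (at x)"
  shows "(\<lambda>z. \<Prod>i\<in>I. F i z) differentiable (at x)"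
  using assms
  by (induction I rule: infinite_finite_induct) (auto intro: differentiable_mult)

lemma differentiable_det:
  fixes A :: "'a::real_normed_vector \<Rightarrow> complex ^ 'n ^ 'n"
  assumes "\<And>i j. (\<lambda>z. A z $ i $ j) differentiable (at x)"
  shows "(\<lambda>z. det (A z)) differentiable (at x)"
  unfolding det_def
  by (intro differentiable_sum ballI differentiable_mult differentiable_prod assms
      differentiable_const finite_permutations finite)

lemma scat_matrix_nth:
  "scat_matrix G f $ i $ j = (if i = j then 1 else 0) - G $ i $ j * complex_of_real (f $ j)"
  by (simp add: scat_matrix_def mat_def matrix_matrix_mult_def diag_def cvec_def
      if_distrib cong: if_cong)

lemma differentiable_of_real_nth:
  "(\<lambda>z::real ^ 'n. complex_of_real (z $ i)) differentiable (at x)"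
  by (intro bounded_linear_imp_differentiable
      bounded_linear_compose[OF bounded_linear_of_real bounded_linear_vec_nth])

lemma differentiable_scat_matrix_nth:
  "(\<lambda>f. scat_matrix G f $ i $ j) differentiable (at x)"
  unfolding scat_matrix_nth
  by (intro differentiable_diff differentiable_mult differentiable_const differentiable_of_real_nth)

lemma matrix_mul_matrix_inv:
  fixes A :: "'a::semiring_1 ^ 'n ^ 'm"
  assumes "invertible A"
  shows "A ** matrix_inv A = mat 1"
  using assms unfolding invertible_def matrix_inv_def by (rule someI2_ex) blast

text \<open>Cramer's rule makes each component of the field a quotient of determinants whose entries
  are affine in \<open>f\<close>, so no derivative of a matrix inverse is required.\<close>

lemma total_field_cramer:
  assumes "det (scat_matrix G f) \<noteq> 0"
  shows "total_field G uin f $ k =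
    det (\<chi> i j. if j = k then uin $ i else scat_matrix G f $ i $ j) / det (scat_matrix G f)"
proof -
  have "scat_matrix G f *v total_field G uin f = uin"
    using assms matrix_mul_matrix_inv[of "scat_matrix G f"]
    by (simp add: total_field_def matrix_vector_mul_assoc invertible_det_nz)
  then have "total_field G uin f = (\<chi> k. det (\<chi> i j. if j = k then uin $ i
      else scat_matrix G f $ i $ j) / det (scat_matrix G f))"
    by (rule iffD1[OF cramer[OF assms]])
  then show ?thesis by simp
qed

lemma differentiable_total_field:
  fixes x :: "real ^ 'n"
  assumes "invertible (scat_matrix G x)"
  shows "(\<lambda>f. total_field G uin f $ k) differentiable (at x)"
proof -
  let ?q = "\<lambda>f. det (\<chi> i j. if j = k then uin $ i else scat_matrix G f $ i $ j)
      / det (scat_matrix G f)"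
  have nz: "det (scat_matrix G x) \<noteq> 0"
    using assms by (simp add: invertible_det_nz)
  have d: "(\<lambda>f. det (scat_matrix G f)) differentiable (at x)"
    by (intro differentiable_det differentiable_scat_matrix_nth)
  have "(\<lambda>f. (\<chi> i j. if j = k then uin $ i else scat_matrix G f $ i $ j) $ i $ j)
      differentiable (at x)" for i j
    by (cases "j = k") (simp_all add: differentiable_scat_matrix_nth)
  then have "?q differentiable (at x)"
    by (intro differentiable_divide differentiable_det d nz)
  \<comment> \<open>Invertibility is assumed at \<open>x\<close> alone. Continuity of the
    determinant spreads it to a neighbourhood, so that the Cramer quotient agrees with the field
    near \<open>x\<close> and passes on its derivative.\<close>
  moreover have "\<forall>\<^sub>F f in nhds x. det (scat_matrix G f) \<noteq> 0"
    using tendsto_imp_eventually_ne[OF isContD[OF differentiable_imp_continuous_within[OF d]] nz] nz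
    by (simp add: eventually_nhds_conv_at)
  then have "\<forall>\<^sub>F f in nhds x. ?q f = total_field G uin f $ k"
    by (rule eventually_mono) (simp add: total_field_cramer)
  ultimately show ?thesis
    unfolding differentiable_def
    by (auto simp: eventually_nhds_conv_at dest: has_derivative_transform_eventually[where s = UNIV])
qed

lemma differentiable_data_fidelity:
  fixes x :: "real ^ 'n"
  assumes "invertible (scat_matrix G x)"
  shows "data_fidelity H G uin y differentiable (at x)"
proof -
  have *: "forward_model H G uin f $ i
      = (\<Sum>j\<in>UNIV. H $ i $ j * total_field G uin f $ j * complex_of_real (f $ j))" for f i
    by (simp add: forward_model_def matrix_vector_mult_def matrix_matrix_mult_def diag_def
        cvec_def if_distrib cong: if_cong)
  \<comment> \<open>The squared norm becomes a sum of real inner products on the complex numbers,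
    which avoids the point where the norm itself is not differentiable.\<close>
  have "data_fidelity H G uin y
      = (\<lambda>f. 1 / 2 * (\<Sum>i\<in>UNIV. (y - forward_model H G uin f) $ i
                         \<bullet> (y - forward_model H G uin f) $ i))"
    by (simp add: fun_eq_iff data_fidelity_def power2_norm_eq_inner inner_vec_def)
  moreover have "\<dots> differentiable (at x)"
    unfolding vector_minus_component *
    by (intro differentiable_mult differentiable_const differentiable_sum ballI differentiable_inner
        differentiable_diff differentiable_total_field differentiable_of_real_nth assms finite)
  ultimately show ?thesis by simp
qed

section \<open>Lipschitz gradients\<close>

text \<open>The descent lemma, with hypotheses on the segment only because \<open>U\<close> is not
  assumed convex.\<close>

lemma lipschitz_gradient_upper_bound:
  fixes \<phi> :: "'a::real_inner \<Rightarrow> real"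
  assumes der: "\<And>p. p \<in> closed_segment z x \<Longrightarrow> GDERIV \<phi> p :> g p"
    and lip: "\<And>p. p \<in> closed_segment z x \<Longrightarrow> norm (g p - g z) \<le> L * norm (p - z)"
  shows "\<phi> x \<le> \<phi> z + g z \<bullet> (x - z) + L / 2 * (norm (x - z))\<^sup>2"
proof -
  let ?d = "x - z"
  \<comment> \<open>Up to the constant \<open>\<phi> z\<close>, \<open>h\<close> is the gap between
    \<open>\<phi>\<close> and its quadratic model along the segment, so \<open>h 1 \<le> h 0\<close>
    is the claim.\<close>
  define h where "h \<theta> = \<phi> (z + \<theta> *\<^sub>R ?d) - \<theta> * (g z \<bullet> ?d) - L / 2 * \<theta>\<^sup>2 * (norm ?d)\<^sup>2" for \<theta>
  have "h 1 \<le> h 0"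
  proof (rule DERIV_nonpos_imp_nonincreasing[of 0 1 h])
    fix \<theta> :: real assume \<theta>: "0 \<le> \<theta>" "\<theta> \<le> 1"
    let ?p = "z + \<theta> *\<^sub>R ?d"
    have p: "?p \<in> closed_segment z x"
      unfolding in_segment using \<theta> by (intro exI[of _ \<theta>]) (simp add: algebra_simps)
    have "((\<lambda>\<theta>. z + \<theta> *\<^sub>R ?d) has_derivative (\<lambda>e. e *\<^sub>R ?d)) (at \<theta>)"
      by (auto intro!: derivative_eq_intros)
    from has_derivative_compose[OF this der[OF p, unfolded gderiv_def]]
    have "((\<lambda>\<theta>. \<phi> (z + \<theta> *\<^sub>R ?d)) has_real_derivative (g ?p \<bullet> ?d)) (at \<theta>)"
      by (rule has_derivative_imp_has_field_derivative) (simp add: inner_commute)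
    then have "(h has_real_derivative (g ?p - g z) \<bullet> ?d - L * \<theta> * (norm ?d)\<^sup>2) (at \<theta>)"
      unfolding h_def by (auto intro!: derivative_eq_intros simp: inner_diff_left)
    moreover have "(g ?p - g z) \<bullet> ?d \<le> L * \<theta> * (norm ?d)\<^sup>2"
    proof -
      have "(g ?p - g z) \<bullet> ?d \<le> norm (g ?p - g z) * norm ?d"
        by (rule norm_cauchy_schwarz)
      also have "\<dots> \<le> (L * norm (?p - z)) * norm ?d"
        by (intro mult_right_mono lip p norm_ge_zero)
      finally show ?thesis using \<theta> by (simp add: power2_eq_square mult.assoc)
    qed
    ultimately show "\<exists>y. DERIV h \<theta> :> y \<and> y \<le> 0" by force
  qed simp
  then show ?thesis by (simp add: h_def)
qed

lemma lipschitz_gradient_lower_bound: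
  fixes \<phi> :: "'a::real_inner \<Rightarrow> real"
  assumes der: "\<And>p. p \<in> closed_segment z x \<Longrightarrow> GDERIV \<phi> p :> g p"
    and lip: "\<And>p. p \<in> closed_segment z x \<Longrightarrow> norm (g p - g z) \<le> L * norm (p - z)"
  shows "\<phi> z + g z \<bullet> (x - z) \<le> \<phi> x + L / 2 * (norm (x - z))\<^sup>2"
proof -
  have "- \<phi> x \<le> - \<phi> z + (- g z) \<bullet> (x - z) + L / 2 * (norm (x - z))\<^sup>2"
    using lip by (intro lipschitz_gradient_upper_bound[where \<phi> = "\<lambda>x. - \<phi> x" and g = "\<lambda>x. - g x"]
        GDERIV_minus der) (auto simp: norm_minus_commute)
  then show ?thesis by simp
qed

section \<open>Proximal operator\<close>

lemma prox_minimizer: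
  fixes C :: "'a::euclidean_space set" and r :: "'a \<Rightarrow> real" and z :: 'a
  assumes "compact C" "C \<noteq> {}" "continuous_on C r" "\<gamma> > 0"
  defines "p \<equiv> prox \<gamma> (\<lambda>x. ereal (r x) + set_chi C x) z"
  shows "p \<in> C"
    and "x \<in> C \<Longrightarrow> 1/2 * (norm (p - z))\<^sup>2 + \<gamma> * r p \<le> 1/2 * (norm (x - z))\<^sup>2 + \<gamma> * r x"
proof -
  let ?e = "\<lambda>x. ereal (1 / 2 * (norm (x - z))\<^sup>2) + ereal \<gamma> * (ereal (r x) + set_chi C x)"
  let ?h = "\<lambda>x. 1/2 * (norm (x - z))\<^sup>2 + \<gamma> * r x"
  \<comment> \<open>Positivity of \<open>\<gamma>\<close> matters: in \<open>ereal\<close>, zero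
    times infinity is zero, and the constraint would be lost.\<close>
  have e: "?e x = (if x \<in> C then ereal (?h x) else \<infinity>)" for x
    using assms(4) by (simp add: set_chi_def)
  have "continuous_on C ?h"
    by (intro continuous_intros assms(3))
  then obtain q where q: "q \<in> C" "\<And>x. x \<in> C \<Longrightarrow> ?h q \<le> ?h x"
    using continuous_attains_inf[OF assms(1,2)] by blast
  then have "is_arg_min ?e (\<lambda>_. True) q"
    unfolding is_arg_min_def e by (auto simp: not_less)
  then have *: "is_arg_min ?e (\<lambda>_. True) p"
    unfolding p_def prox_def arg_min_def by (rule someI)
  then have "\<not> ?e q < ?e p" by (auto simp: is_arg_min_def)
  with q(1) show "p \<in> C" unfolding e by (auto split: if_splits)
  then show "?h p \<le> ?h x" if "x \<in> C"
  proof -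
    have "\<not> ?e x < ?e p" using * by (auto simp: is_arg_min_def)
    with that \<open>p \<in> C\<close> show ?thesis unfolding e by simp
  qed
qed

text \<open>First-order optimality: comparing \<open>p\<close> with \<open>p + \<theta> (x - p)\<close> and letting \<open>\<theta> \<rightarrow> 0\<close>
  shows that \<open>(z - p) / \<gamma>\<close> is a subgradient at \<open>p\<close>.\<close>

lemma prox_variational_inequality:
  fixes C :: "'a::euclidean_space set" and r :: "'a \<Rightarrow> real" and z :: 'a
  assumes "compact C" "C \<noteq> {}" "continuous_on C r" "\<gamma> > 0" "convex_on C r" "x \<in> C"
  defines "p \<equiv> prox \<gamma> (\<lambda>x. ereal (r x) + set_chi C x) z"
  shows "(z - p) \<bullet> (x - p) \<le> \<gamma> * (r x - r p)"
proof -
  have p: "p \<in> C"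
    and min: "\<And>x. x \<in> C \<Longrightarrow> 1/2 * (norm (p - z))\<^sup>2 + \<gamma> * r p \<le> 1/2 * (norm (x - z))\<^sup>2 + \<gamma> * r x"
    unfolding p_def by (fact prox_minimizer[OF assms(1-4)])+
  let ?l = "(z - p) \<bullet> (x - p) - \<gamma> * (r x - r p)"
  have *: "?l \<le> \<theta> / 2 * (norm (x - p))\<^sup>2" if "0 < \<theta>" "\<theta> \<le> 1" for \<theta>
  proof -
    let ?w = "(1 - \<theta>) *\<^sub>R p + \<theta> *\<^sub>R x"
    have "?w \<in> C"
      using convexD_alt[OF convex_on_imp_convex[OF assms(5)] p assms(6)] that by simp
    then have "1/2 * (norm (p - z))\<^sup>2 + \<gamma> * r p \<le> 1/2 * (norm (?w - z))\<^sup>2 + \<gamma> * r ?w"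
      by (rule min)
    moreover have "\<gamma> * r ?w \<le> \<gamma> * ((1 - \<theta>) * r p + \<theta> * r x)"
      using convex_onD[OF assms(5), of \<theta> p x] that p assms(4,6) by simp
    moreover have "?w - z = (p - z) + \<theta> *\<^sub>R (x - p)"
      by (simp add: algebra_simps)
    ultimately have "1/2 * (norm (p - z))\<^sup>2 + \<gamma> * r p
        \<le> 1/2 * (norm ((p - z) + \<theta> *\<^sub>R (x - p)))\<^sup>2 + \<gamma> * ((1 - \<theta>) * r p + \<theta> * r x)"
      by simp
    then have "\<theta> * ?l \<le> \<theta> * (\<theta> / 2 * (norm (x - p))\<^sup>2)"
      unfolding power2_norm_eq_inner
      by (simp add: inner_add_left inner_add_right inner_diff_left inner_diff_right inner_commute
          algebra_simps)
    then show ?thesis using that by simp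
  qed
  have "((\<lambda>\<theta>. \<theta> / 2 * (norm (x - p))\<^sup>2) \<longlongrightarrow> 0 / 2 * (norm (x - p))\<^sup>2) (at_right 0)"
    by (intro tendsto_intros) simp
  moreover have "\<forall>\<^sub>F \<theta> in at_right 0. ?l \<le> \<theta> / 2 * (norm (x - p))\<^sup>2"
    using eventually_at_right_real[OF zero_less_one]
    by (rule eventually_mono) (rule *, simp_all)
  ultimately have "?l \<le> 0 / 2 * (norm (x - p))\<^sup>2"
    by (rule tendsto_lowerbound) simp
  then show ?thesis by simp
qed

text \<open>The variational inequalities at \<open>z\<close> and \<open>w\<close>, each tested at
  the other's proximal point, are added; the \<open>r\<close> terms cancel and Cauchy-Schwarz
  finishes.\<close>

lemma prox_nonexpansive:
  fixes C :: "'a::euclidean_space set"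
  assumes "compact C" "C \<noteq> {}" "continuous_on C r" "\<gamma> > 0" "convex_on C r"
  defines "P \<equiv> prox \<gamma> (\<lambda>x. ereal (r x) + set_chi C x)"
  shows "norm (P z - P w) \<le> norm (z - w)"
proof -
  note in_C = prox_minimizer(1)[OF assms(1-4), folded P_def]
  have "(z - P z) \<bullet> (P w - P z) \<le> \<gamma> * (r (P w) - r (P z))"
    and "(w - P w) \<bullet> (P z - P w) \<le> \<gamma> * (r (P z) - r (P w))"
    using prox_variational_inequality[OF assms(1-5) in_C, folded P_def] by blast+
  then have "(norm (P z - P w))\<^sup>2 \<le> (z - w) \<bullet> (P z - P w)"
    unfolding power2_norm_eq_inner
    by (simp add: inner_diff_left inner_diff_right inner_commute algebra_simps)
  also have "\<dots> \<le> norm (z - w) * norm (P z - P w)"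
    by (rule norm_cauchy_schwarz)
  finally show ?thesis
    by (cases "P z = P w") (simp_all add: power2_eq_square)
qed

section \<open>Accelerated proximal gradient steps\<close>

text \<open>The first bound lets the energy absorb the extrapolation error; the second makes the
  guaranteed decrease positive.\<close>

lemma relaxed_step_bound:
  fixes \<alpha> \<gamma> L :: real
  assumes "0 \<le> \<alpha>" "\<alpha> < 1" "L > 0" "\<gamma> \<le> (1 - \<alpha>\<^sup>2) / (2 * L)"
  shows "(1 + \<gamma> * L) * \<alpha>\<^sup>2 \<le> 1" and "\<gamma> * L < 1"
proof -
  have a: "0 \<le> \<alpha>\<^sup>2" "\<alpha>\<^sup>2 < 1"
    using assms by (auto simp: power_less_one_iff abs_square_less_1)
  have b: "\<gamma> * L \<le> (1 - \<alpha>\<^sup>2) / 2"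
    using assms by (simp add: field_simps)
  with a show "\<gamma> * L < 1" by argo
  have "(1 + \<gamma> * L) * \<alpha>\<^sup>2 \<le> (1 + (1 - \<alpha>\<^sup>2) / 2) * \<alpha>\<^sup>2"
    using b by (intro mult_right_mono) auto
  also have "\<dots> = 1 - (1 - \<alpha>\<^sup>2) * (2 - \<alpha>\<^sup>2) / 2"
    by (simp add: field_simps)
  also have "\<dots> \<le> 1" using a by simp
  finally show "(1 + \<gamma> * L) * \<alpha>\<^sup>2 \<le> 1" .
qed

text \<open>Separates the convergence argument from the scattering model. Covering refers to points
  of \<open>C\<close> only; a starting point outside \<open>C\<close> is handled in the final
  theorem.\<close>

locale relaxed_prox_gradient =
  fixes C U :: "'a::euclidean_space set"
    and \<phi> r :: "'a \<Rightarrow> real" and g :: "'a \<Rightarrow> 'a" and \<alpha> \<gamma> L :: real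
  assumes compact: "compact C" and nonempty: "C \<noteq> {}"
    and cont: "continuous_on C r" and convex_r: "convex_on C r"
    and cover: "x \<in> C \<Longrightarrow> x' \<in> C \<Longrightarrow> 0 \<le> \<beta> \<Longrightarrow> \<beta> < 1 \<Longrightarrow> x + \<beta> *\<^sub>R (x - x') \<in> U"
    and der: "x \<in> U \<Longrightarrow> GDERIV \<phi> x :> g x"
    and lip: "L-lipschitz_on U g"
    and \<gamma>_pos: "0 < \<gamma>" and L_pos: "L > 0" and \<alpha>: "0 \<le> \<alpha>" "\<alpha> < 1"
    and \<gamma>_le: "\<gamma> \<le> (1 - \<alpha>\<^sup>2) / (2 * L)"
begin

abbreviation "P \<equiv> prox \<gamma> (\<lambda>x. ereal (r x) + set_chi C x)"
abbreviation "step x \<equiv> P (x - \<gamma> *\<^sub>R g x)"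

lemma prox_in [simp]: "P z \<in> C"
  using prox_minimizer(1)[OF compact nonempty cont \<gamma>_pos] .

lemma C_subset_U: "x \<in> C \<Longrightarrow> x \<in> U"
  using cover[of x x 0] by simp

lemma lip_norm: "x \<in> U \<Longrightarrow> z \<in> U \<Longrightarrow> norm (g x - g z) \<le> L * norm (x - z)"
  using lipschitz_onD[OF lip] by (simp add: dist_norm)

text \<open>Substitutes for convexity of \<open>U\<close>: contracting an extrapolated point towards
  \<open>q\<close> gives the extrapolation, with the same \<open>\<beta>\<close>, of the contracted
  points, which stay in the convex set \<open>C\<close>.\<close>

lemma segment_in_U:
  assumes "x \<in> C" "x' \<in> C" "q \<in> C" "0 \<le> \<beta>" "\<beta> < 1"
  shows "closed_segment (x + \<beta> *\<^sub>R (x - x')) q \<subseteq> U"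
proof
  fix w assume "w \<in> closed_segment (x + \<beta> *\<^sub>R (x - x')) q"
  then obtain \<theta> where \<theta>: "0 \<le> \<theta>" "\<theta> \<le> 1"
    and w: "w = (1 - \<theta>) *\<^sub>R (x + \<beta> *\<^sub>R (x - x')) + \<theta> *\<^sub>R q"
    by (auto simp: in_segment)
  let ?a = "(1 - \<theta>) *\<^sub>R x + \<theta> *\<^sub>R q" and ?b = "(1 - \<theta>) *\<^sub>R x' + \<theta> *\<^sub>R q"
  have "?a \<in> C" "?b \<in> C"
    using convexD_alt[OF convex_on_imp_convex[OF convex_r]] assms \<theta> by auto
  then have "?a + \<beta> *\<^sub>R (?a - ?b) \<in> U"
    by (rule cover) fact+
  also have "?a + \<beta> *\<^sub>R (?a - ?b) = w"
    unfolding w by (simp add: algebra_simps)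
  finally show "w \<in> U" .
qed

definition energy :: "'a \<Rightarrow> 'a \<Rightarrow> real"
  where "energy x x' = \<phi> x + r x + 1 / (2 * \<gamma>) * (norm (x - x'))\<^sup>2"

lemma energy_decrease:
  assumes x: "x \<in> C" "x' \<in> C" and \<beta>: "0 \<le> \<beta>" "\<beta> \<le> \<alpha>"
    and s_def: "s = x + \<beta> *\<^sub>R (x - x')"
  shows "(1 - \<gamma> * L) / (2 * \<gamma>) * (norm (step s - s))\<^sup>2 \<le> energy x x' - energy (step s) x"
proof -
  define p where "p = step s"
  have p: "p \<in> C" unfolding p_def by simp
  have \<beta>1: "\<beta> < 1" using \<beta> \<alpha> by simp
  have sU: "s \<in> U" unfolding s_def using x \<beta> \<beta>1 by (intro cover)
  have seg: "closed_segment s q \<subseteq> U" if "q \<in> C" for q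
    unfolding s_def using segment_in_U[OF x that \<beta>(1) \<beta>1] .
  have "\<phi> p \<le> \<phi> s + g s \<bullet> (p - s) + L / 2 * (norm (p - s))\<^sup>2"
    using seg[OF p] sU
    by (intro lipschitz_gradient_upper_bound) (auto intro: der lip_norm)
  \<comment> \<open>As \<open>\<phi>\<close> need not be convex, its tangent at \<open>s\<close> is
    a lower bound only up to a quadratic error, which the extrapolation has to pay for.\<close>
  moreover have "\<phi> s + g s \<bullet> (x - s) \<le> \<phi> x + L / 2 * (norm (x - s))\<^sup>2"
    using seg[OF x(1)] sU
    by (intro lipschitz_gradient_lower_bound) (auto intro: der lip_norm)
  \<comment> \<open>The proximal inequality tested at \<open>x\<close>, rewritten by polarization
    and divided by \<open>\<gamma>\<close>.\<close>
  moreover have "1 / (2 * \<gamma>) * (norm (p - s))\<^sup>2 + 1 / (2 * \<gamma>) * (norm (p - x))\<^sup>2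
        - 1 / (2 * \<gamma>) * (norm (x - s))\<^sup>2 \<le> r x - r p + g s \<bullet> (x - p)"
  proof -
    have "(s - \<gamma> *\<^sub>R g s - p) \<bullet> (x - p) \<le> \<gamma> * (r x - r p)"
      unfolding p_def
      by (rule prox_variational_inequality[OF compact nonempty cont \<gamma>_pos convex_r x(1)])
    moreover have "(s - \<gamma> *\<^sub>R g s - p) \<bullet> (x - p) = (s - p) \<bullet> (x - p) - \<gamma> * (g s \<bullet> (x - p))"
      by (simp add: inner_diff_left)
    moreover have "(s - p) \<bullet> (x - p)
        = 1 / 2 * ((norm (p - s))\<^sup>2 + (norm (p - x))\<^sup>2 - (norm (x - s))\<^sup>2)"
      unfolding power2_norm_eq_inner
      by (simp add: inner_diff_left inner_diff_right inner_commute)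
    ultimately have "1 / 2 * ((norm (p - s))\<^sup>2 + (norm (p - x))\<^sup>2 - (norm (x - s))\<^sup>2)
        \<le> \<gamma> * (r x - r p + g s \<bullet> (x - p))"
      unfolding distrib_left by linarith
    then have "1 / \<gamma> * (1 / 2 * ((norm (p - s))\<^sup>2 + (norm (p - x))\<^sup>2 - (norm (x - s))\<^sup>2))
        \<le> 1 / \<gamma> * (\<gamma> * (r x - r p + g s \<bullet> (x - p)))"
      using \<gamma>_pos by (intro mult_left_mono) simp_all
    then show ?thesis
      using \<gamma>_pos by (simp add: add_divide_distrib diff_divide_distrib)
  qed
  moreover have "g s \<bullet> (p - s) - g s \<bullet> (x - s) + g s \<bullet> (x - p) = 0"
    by (simp add: inner_diff_right)
  ultimately have *: "\<phi> p + r p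
        + 1 / (2 * \<gamma>) * (norm (p - s))\<^sup>2 + 1 / (2 * \<gamma>) * (norm (p - x))\<^sup>2
        - 1 / (2 * \<gamma>) * (norm (x - s))\<^sup>2
      \<le> \<phi> x + r x + L / 2 * (norm (p - s))\<^sup>2 + L / 2 * (norm (x - s))\<^sup>2"
    by linarith
  \<comment> \<open>The terms in \<open>norm (x - s)\<close> have total coefficient
    \<open>(1 + \<gamma> * L) / (2 * \<gamma>)\<close>; the step size bound lets the last term of
    \<open>energy x x'\<close> absorb them.\<close>
  have "norm (x - s) = \<beta> * norm (x - x')"
    using \<beta> by (simp add: s_def)
  then have "(norm (x - s))\<^sup>2 \<le> \<alpha>\<^sup>2 * (norm (x - x'))\<^sup>2"
    using \<beta> \<alpha> by (simp add: power_mult_distrib mult_right_mono power_mono)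
  then have "(1 + \<gamma> * L) * (norm (x - s))\<^sup>2 \<le> (1 + \<gamma> * L) * \<alpha>\<^sup>2 * (norm (x - x'))\<^sup>2"
    using \<gamma>_pos L_pos unfolding mult.assoc by (intro mult_left_mono) simp_all
  also have "\<dots> \<le> 1 * (norm (x - x'))\<^sup>2"
    using relaxed_step_bound(1)[OF \<alpha> L_pos \<gamma>_le] by (intro mult_right_mono) auto
  finally have "1 / (2 * \<gamma>) * ((1 + \<gamma> * L) * (norm (x - s))\<^sup>2) \<le> 1 / (2 * \<gamma>) * (norm (x - x'))\<^sup>2"
    using \<gamma>_pos by (intro mult_left_mono) auto
  moreover have "1 / (2 * \<gamma>) * ((1 + \<gamma> * L) * (norm (x - s))\<^sup>2)
      = 1 / (2 * \<gamma>) * (norm (x - s))\<^sup>2 + L / 2 * (norm (x - s))\<^sup>2"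
    and "(1 - \<gamma> * L) / (2 * \<gamma>) * (norm (p - s))\<^sup>2
      = 1 / (2 * \<gamma>) * (norm (p - s))\<^sup>2 - L / 2 * (norm (p - s))\<^sup>2"
    using \<gamma>_pos by (simp_all add: field_simps)
  ultimately show ?thesis
    using * unfolding energy_def p_def[symmetric] by linarith
qed

text \<open>Both \<open>step s\<close> and \<open>step (step s)\<close> are proximal points, so
  nonexpansiveness compares their arguments: the shift contributes 1 and the change of gradient
  \<open>\<gamma> * L\<close>.\<close>

lemma gradient_mapping_bound:
  assumes "s \<in> U"
  shows "norm ((step s - step (step s)) /\<^sub>R \<gamma>) \<le> (1 + \<gamma> * L) / \<gamma> * norm (step s - s)"
proof -
  let ?p = "step s"
  have "norm (?p - step ?p) \<le> norm ((s - \<gamma> *\<^sub>R g s) - (?p - \<gamma> *\<^sub>R g ?p))"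
    by (rule prox_nonexpansive[OF compact nonempty cont \<gamma>_pos convex_r])
  also have "\<dots> = norm (\<gamma> *\<^sub>R (g ?p - g s) - (?p - s))"
    by (simp add: algebra_simps)
  also have "\<dots> \<le> \<gamma> * norm (g ?p - g s) + norm (?p - s)"
    using norm_triangle_ineq4[of "\<gamma> *\<^sub>R (g ?p - g s)" "?p - s"] \<gamma>_pos by simp
  also have "\<dots> \<le> \<gamma> * (L * norm (?p - s)) + norm (?p - s)"
    using \<gamma>_pos by (intro add_right_mono mult_left_mono lip_norm C_subset_U prox_in assms) auto
  also have "\<dots> = (1 + \<gamma> * L) * norm (?p - s)"
    by (simp add: algebra_simps)
  finally show ?thesis
    using \<gamma>_pos by (simp add: divide_inverse_commute mult.assoc)
qed

text \<open>The truncated \<open>k - 1\<close> makes \<open>s (Suc 0) = f 0\<close> the case \<open>k = 0\<close> of the extrapolation rule.\<close>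

context
  fixes f s :: "nat \<Rightarrow> 'a" and \<beta> :: "nat \<Rightarrow> real"
  assumes \<beta>: "\<And>k. 0 \<le> \<beta> k" "\<And>k. \<beta> k \<le> \<alpha>"
    and f_step: "\<And>k. f (Suc k) = step (s (Suc k))"
    and s_step: "\<And>k. s (Suc k) = f k + \<beta> k *\<^sub>R (f k - f (k - 1))"
begin

text \<open>Telescopes \<open>energy_decrease\<close> and drops the nonnegative distance term of the
  final energy. The start \<open>m\<close> allows skipping iterates outside
  \<open>C\<close>.\<close>

lemma sum_residuals_le:
  assumes "\<And>k. m \<le> k \<Longrightarrow> f k \<in> C \<and> f (k - 1) \<in> C" and "m \<le> n"
  shows "(1 - \<gamma> * L) / (2 * \<gamma>) * (\<Sum>k=m..<n. (norm (f (Suc k) - s (Suc k)))\<^sup>2)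
    \<le> energy (f m) (f (m - 1)) - (\<phi> (f n) + r (f n))"
proof -
  have "(1 - \<gamma> * L) / (2 * \<gamma>) * (\<Sum>k=m..<n. (norm (f (Suc k) - s (Suc k)))\<^sup>2)
      \<le> energy (f m) (f (m - 1)) - energy (f n) (f (n - 1))"
    using assms(2)
  proof (induction n rule: dec_induct)
    case (step n)
    have "(1 - \<gamma> * L) / (2 * \<gamma>) * (norm (f (Suc n) - s (Suc n)))\<^sup>2
        \<le> energy (f n) (f (n - 1)) - energy (f (Suc n)) (f n)"
      using energy_decrease[OF _ _ \<beta> s_step] assms(1)[OF step(1)] by (simp add: f_step)
    with step show ?case by (simp add: distrib_left)
  qed simp
  moreover have "0 \<le> 1 / (2 * \<gamma>) * (norm (f n - f (n - 1)))\<^sup>2"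
    using \<gamma>_pos by simp
  ultimately show ?thesis unfolding energy_def by linarith
qed

text \<open>The lower bound \<open>b\<close> keeps the total decrease finite, so the squared
  residuals from index \<open>m\<close> on are summable and tend to 0.\<close>

lemma residuals_tendsto_0:
  assumes m: "\<And>k. m \<le> k \<Longrightarrow> f k \<in> C \<and> f (k - 1) \<in> C"
    and lower: "\<And>x. x \<in> C \<Longrightarrow> b \<le> \<phi> x + r x"
  shows "(\<lambda>k. norm (f k - s k)) \<longlonglongrightarrow> 0"
proof -
  let ?c = "(1 - \<gamma> * L) / (2 * \<gamma>)" and ?a = "\<lambda>k. (norm (f (Suc k) - s (Suc k)))\<^sup>2"
  let ?B = "(energy (f m) (f (m - 1)) - b) / ?c"
  have c: "?c > 0"
    using relaxed_step_bound(2)[OF \<alpha> L_pos \<gamma>_le] \<gamma>_pos by simp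
  have "(\<Sum>k<n. ?a (k + m)) \<le> ?B" for n
  proof -
    have "?c * (\<Sum>k=m..<n + m. ?a k) \<le> energy (f m) (f (m - 1)) - b"
      using sum_residuals_le[OF m, of m "n + m"] lower[of "f (n + m)"] m[of "n + m"] by simp
    then have "(\<Sum>k=m..<n + m. ?a k) \<le> ?B"
      using c by (simp only: pos_le_divide_eq mult.commute)
    then show ?thesis
      using sum.shift_bounds_nat_ivl[of ?a 0 m n] by (simp add: atLeast0LessThan)
  qed
  then have "summable (\<lambda>k. ?a (k + m))"
    by (intro summableI_nonneg_bounded) auto
  then have "?a \<longlonglongrightarrow> 0"
    by (intro summable_LIMSEQ_zero) (rule iffD1[OF summable_iff_shift])
  then have "(\<lambda>k. sqrt (?a k)) \<longlonglongrightarrow> sqrt 0"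
    by (rule tendsto_real_sqrt)
  then have "(\<lambda>k. norm (f (Suc k) - s (Suc k))) \<longlonglongrightarrow> 0"
    by simp
  then show ?thesis by (rule LIMSEQ_imp_Suc)
qed

text \<open>The minimum is at most the average over \<open>K\<close> iterates, which the telescoped
  energy bounds.\<close>

lemma Min_gradient_mapping_le:
  assumes f0: "f 0 \<in> C" and lower: "\<And>x. x \<in> C \<Longrightarrow> b \<le> \<phi> x + r x" and "0 < K"
  shows "Min ((\<lambda>k. (norm ((f k - step (f k)) /\<^sub>R \<gamma>))\<^sup>2) ` {1..K})
    \<le> 2 * (1 + \<gamma> * L)\<^sup>2 * (\<phi> (f 0) + r (f 0) - b) / (real K * \<gamma> * (1 - \<gamma> * L))"
    (is "?M \<le> _")
proof -
  let ?a = "\<lambda>k. (norm (f (Suc k) - s (Suc k)))\<^sup>2" and ?q = "(1 + \<gamma> * L)\<^sup>2 / \<gamma>\<^sup>2"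
  have fC: "f k \<in> C" for k
    using f0 by (cases k) (simp_all add: f_step)
  have sU: "s (Suc k) \<in> U" for k
    unfolding s_step using \<beta>[of k] \<alpha> by (intro cover fC) auto
  \<comment> \<open>\<open>?a k\<close> belongs to the iterate \<open>f (Suc k)\<close>, so
    \<open>k < K\<close> runs through the indices 1 to \<open>K\<close>.\<close>
  have "?M \<le> ?q * ?a k" if "k < K" for k
  proof -
    have "?M \<le> (norm ((f (Suc k) - step (f (Suc k))) /\<^sub>R \<gamma>))\<^sup>2"
      using that by (intro Min_le) auto
    also have "\<dots> \<le> ((1 + \<gamma> * L) / \<gamma> * norm (f (Suc k) - s (Suc k)))\<^sup>2"
      using gradient_mapping_bound[OF sU[of k]] by (intro power_mono) (simp_all add: f_step)
    finally show ?thesis by (simp add: power_mult_distrib power_divide)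
  qed
  then have "real K * ?M \<le> ?q * (\<Sum>k<K. ?a k)"
    using sum_mono[of "{..<K}" "\<lambda>_. ?M" "\<lambda>k. ?q * ?a k"] by (simp add: sum_distrib_left)
  also have "?q * (\<Sum>k<K. ?a k) \<le> ?q * (2 * \<gamma> / (1 - \<gamma> * L) * (\<phi> (f 0) + r (f 0) - b))"
  proof (rule mult_left_mono)
    have "(1 - \<gamma> * L) / (2 * \<gamma>) * (\<Sum>k<K. ?a k) \<le> \<phi> (f 0) + r (f 0) - b"
      \<comment> \<open>For \<open>m = 0\<close> truncated subtraction gives
        \<open>f (m - 1) = f 0\<close>, so the initial energy has no distance term.\<close>
      using sum_residuals_le[of 0 K] fC lower[OF fC, of K]
      by (simp add: energy_def atLeast0LessThan)
    then show "(\<Sum>k<K. ?a k) \<le> 2 * \<gamma> / (1 - \<gamma> * L) * (\<phi> (f 0) + r (f 0) - b)"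
      using relaxed_step_bound(2)[OF \<alpha> L_pos \<gamma>_le] \<gamma>_pos by (simp add: field_simps)
  qed simp
  finally have "?M \<le> ?q * (2 * \<gamma> / (1 - \<gamma> * L) * (\<phi> (f 0) + r (f 0) - b)) / real K"
    using \<open>0 < K\<close> by (intro mult_imp_le_div_pos) (simp_all only: of_nat_0_less_iff mult.commute)
  also have "a / \<gamma>\<^sup>2 * (2 * \<gamma> / d * c) / n = 2 * a * c / (n * \<gamma> * d)" for a c d n :: real
    using \<gamma>_pos by (simp add: power2_eq_square mult_ac)
  finally show ?thesis .
qed

end

end

section \<open>Relaxed FISTA\<close>

text \<open>Since \<open>sqrt (4 * (t k)\<^sup>2 + 1)\<close> is at least \<open>2 * t k\<close>,
  the sequence increases from 1, whence \<open>0 \<le> t k - 1 \<le> t (Suc k)\<close>.\<close>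

lemma fista_momentum:
  fixes t :: "nat \<Rightarrow> real"
  assumes "t 0 = 1" "\<And>k. t (Suc k) = (sqrt (4 * (t k)\<^sup>2 + 1) + 1) / 2"
  shows "0 \<le> (t k - 1) / t (Suc k)" "(t k - 1) / t (Suc k) \<le> 1"
proof -
  have inc: "t k \<le> t (Suc k)" for k
  proof -
    have "2 * t k \<le> sqrt (4 * (t k)\<^sup>2 + 1)"
      by (rule real_le_rsqrt) (simp add: power_mult_distrib)
    then show ?thesis unfolding assms(2) by simp
  qed
  have "1 \<le> t k" for k
    by (induction k) (auto simp: assms(1) intro: order_trans inc)
  from this[of k] inc[of k]
  show "0 \<le> (t k - 1) / t (Suc k)" "(t k - 1) / t (Suc k) \<le> 1"
    by (auto simp: divide_simps)
qed

section \<open>Convexity and continuity of the total variation\<close>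

definition total_variation :: "real \<Rightarrow> (nat \<Rightarrow> real ^ 'n \<Rightarrow> real ^ 'n) \<Rightarrow> real ^ 'n \<Rightarrow> real"
  where "total_variation \<tau> D x = \<tau> * (\<Sum>n\<in>UNIV. L2_set (\<lambda>d. D d x $ n) {1..2})"

lemma regularizer_total_variation:
  "regularizer \<tau> D C = (\<lambda>x. ereal (total_variation \<tau> D x) + set_chi C x)"
  by (simp add: fun_eq_iff regularizer_def total_variation_def L2_set_def)

lemma total_variation_nonneg: "0 \<le> \<tau> \<Longrightarrow> 0 \<le> total_variation \<tau> D x"
  by (simp add: total_variation_def sum_nonneg)

lemma convex_on_sum_functions:
  assumes "convex C" "\<And>i. i \<in> I \<Longrightarrow> convex_on C (h i)"
  shows "convex_on C (\<lambda>x. \<Sum>i\<in>I. h i x :: real)"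
  using assms
  by (induction I rule: infinite_finite_induct) (auto simp: convex_on_const)

text \<open>Each summand is a Euclidean norm of a linear image of \<open>x\<close>; its form as an
  \<open>L2_set\<close> gives access to the triangle inequality.\<close>

lemma convex_on_total_variation:
  assumes "0 \<le> \<tau>" "\<And>d. d \<in> {1..2} \<Longrightarrow> linear (D d)" "convex C"
  shows "convex_on C (total_variation \<tau> D)"
proof -
  have "convex_on C (\<lambda>x. L2_set (\<lambda>d. D d x $ n) {1..2})" for n
  proof (rule convex_onI)
    fix \<theta> :: real and x z assume \<theta>: "0 < \<theta>" "\<theta> < 1"
    have "L2_set (\<lambda>d. D d ((1 - \<theta>) *\<^sub>R x + \<theta> *\<^sub>R z) $ n) {1..2}
        = L2_set (\<lambda>d. (1 - \<theta>) * D d x $ n + \<theta> * D d z $ n) {1..2}"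
      using assms(2) by (intro L2_set_cong) (simp_all add: linear_add linear_scale)
    also have "\<dots> \<le> L2_set (\<lambda>d. (1 - \<theta>) * D d x $ n) {1..2} + L2_set (\<lambda>d. \<theta> * D d z $ n) {1..2}"
      by (rule L2_set_triangle_ineq)
    also have "\<dots> = (1 - \<theta>) * L2_set (\<lambda>d. D d x $ n) {1..2} + \<theta> * L2_set (\<lambda>d. D d z $ n) {1..2}"
      using \<theta> by (simp add: L2_set_right_distrib)
    finally show "L2_set (\<lambda>d. D d ((1 - \<theta>) *\<^sub>R x + \<theta> *\<^sub>R z) $ n) {1..2} \<le> \<dots>" .
  qed fact
  then show ?thesis
    unfolding total_variation_def using assms
    by (intro convex_on_cmul convex_on_sum_functions) auto
qed

lemma continuous_on_total_variation:
  assumes "\<And>d. d \<in> {1..2} \<Longrightarrow> linear (D d)"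
  shows "continuous_on C (total_variation \<tau> D)"
  unfolding total_variation_def L2_set_def
  by (intro continuous_intros linear_continuous_on) (rule iffD1[OF linear_conv_bounded_linear assms])

theorem proposition3:
  fixes H :: "complex ^ 'n ^ 'm" and G :: "complex ^ 'n ^ 'n"
    and uin :: "complex ^ 'n" and y :: "complex ^ 'm"
    and \<tau> \<alpha> \<gamma> L :: real
    and D :: "nat \<Rightarrow> real ^ 'n \<Rightarrow> real ^ 'n"
    and C U :: "(real ^ 'n) set"
    and f0 :: "real ^ 'n"
    and f s :: "nat \<Rightarrow> real ^ 'n" and t :: "nat \<Rightarrow> real"
    and \<D> :: "real ^ 'n \<Rightarrow> real"
    and \<R> \<F> :: "real ^ 'n \<Rightarrow> ereal"
  defines "\<D> \<equiv> data_fidelity H G uin y"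
    and "\<R> \<equiv> regularizer \<tau> D C"
    and "\<F> \<equiv> (\<lambda>x. ereal (\<D> x) + \<R> x)"
  assumes "\<tau> > 0"
    and "\<And>d. d \<in> {1..2} \<Longrightarrow> linear (D d)"
    and "C \<noteq> {}" "bounded C" "closed C" "convex C"
    and "0 \<le> \<alpha>" "\<alpha> < 1"
    and "t 0 = 1" "\<And>k. t (Suc k) = (sqrt (4 * (t k)\<^sup>2 + 1) + 1) / 2"
    and "f 0 = f0" "s 1 = f0"
    and "\<And>k. k \<ge> 1 \<Longrightarrow> f k = prox \<gamma> \<R> (s k - \<gamma> *\<^sub>R gradient \<D> (s k))"
    and "\<And>k. k \<ge> 1 \<Longrightarrow>
           s (Suc k) = f k + (\<alpha> * ((t k - 1) / t (Suc k))) *\<^sub>R (f k - f (k - 1))"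
    and "bounded U"
    and "\<And>x x' \<beta>. x \<in> C \<union> {f0} \<Longrightarrow> x' \<in> C \<union> {f0} \<Longrightarrow> 0 \<le> \<beta> \<Longrightarrow> \<beta> < 1 \<Longrightarrow>
           x + \<beta> *\<^sub>R (x - x') \<in> U"
    and "\<And>x. x \<in> U \<Longrightarrow> invertible (scat_matrix G x)"
    and "L > 0" "L-lipschitz_on U (gradient \<D>)"
    and "0 < \<gamma>" "\<gamma> \<le> (1 - \<alpha>\<^sup>2) / (2 * L)"
  shows "(\<lambda>k. norm (gradient_mapping \<gamma> \<D> \<R> (f k))) \<longlonglongrightarrow> 0 \<and>
    (\<forall>Fstar K. (\<exists>x. \<F> x = Fstar) \<and> (\<forall>x. Fstar \<le> \<F> x) \<and> (0::nat) < K \<longrightarrow>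
       ereal (Min ((\<lambda>k. (norm (gradient_mapping \<gamma> \<D> \<R> (f k)))\<^sup>2) ` {1..K}))
         \<le> ereal (2 * L * (3 + \<gamma> * L)\<^sup>2) * (\<F> f0 - Fstar)
             / ereal (real K * \<gamma> * L * (1 - \<gamma> * L)))"
proof -
  let ?r = "total_variation \<tau> D" and ?\<beta> = "\<lambda>k. \<alpha> * ((t k - 1) / t (Suc k))"
  note f_rec = assms(16) and s_rec = assms(17) and U_cover = assms(19)
  have R: "\<R> = (\<lambda>x. ereal (?r x) + set_chi C x)"
    unfolding assms(2) by (rule regularizer_total_variation)
  interpret relaxed_prox_gradient C U \<D> ?r "gradient \<D>" \<alpha> \<gamma> L
  proof
    show "compact C" using \<open>bounded C\<close> \<open>closed C\<close> by (simp add: compact_eq_bounded_closed)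
    show "GDERIV \<D> x :> gradient \<D> x" if "x \<in> U" for x
      unfolding \<D>_def
      by (intro differentiable_imp_GDERIV_gradient differentiable_data_fidelity assms that)
    show "continuous_on C ?r" by (intro continuous_on_total_variation assms)
    show "convex_on C ?r"
      by (intro convex_on_total_variation assms less_imp_le[OF \<open>\<tau> > 0\<close>])
    show "x + \<beta> *\<^sub>R (x - x') \<in> U" if "x \<in> C" "x' \<in> C" "0 \<le> \<beta>" "\<beta> < 1" for x x' \<beta>
      using that by (intro U_cover) auto
  qed (fact assms)+
  have \<beta>: "0 \<le> ?\<beta> k" "?\<beta> k \<le> \<alpha>" for k
    using fista_momentum[OF assms(12,13), of k] \<open>0 \<le> \<alpha>\<close>
    by (blast intro: mult_nonneg_nonneg mult_left_le)+
  have f_step: "f (Suc k) = step (s (Suc k))" for k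
    using f_rec[of "Suc k"] by (simp add: R)
  have s_step: "s (Suc k) = f k + ?\<beta> k *\<^sub>R (f k - f (k - 1))" for k
    using s_rec[of k] \<open>f 0 = f0\<close> \<open>s 1 = f0\<close> by (cases k) simp_all
  have fC: "f (Suc k) \<in> C" for k
    by (simp add: f_step)
  have f_mem: "f k \<in> C \<union> {f0}" for k
    using fC \<open>f 0 = f0\<close> by (cases k) auto
  \<comment> \<open>Covering is applied with \<open>f0\<close> included, since the first
    extrapolations may involve a starting point outside \<open>C\<close>.\<close>
  have sU: "s (Suc k) \<in> U" for k
    unfolding s_step using \<beta>[of k] \<open>\<alpha> < 1\<close> by (intro U_cover f_mem) auto
  have gm: "gradient_mapping \<gamma> \<D> \<R> x = (x - step x) /\<^sub>R \<gamma>" for x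
    by (simp add: gradient_mapping_def R)
  have \<D>_nonneg: "0 \<le> \<D> x" for x
    by (simp add: \<D>_def data_fidelity_def)
  have F_C: "\<F> x = ereal (\<D> x + ?r x)" if "x \<in> C" for x
    using that by (simp add: \<F>_def R set_chi_def)
  have F_notC: "\<F> x = \<infinity>" if "x \<notin> C" for x
    using that by (simp add: \<F>_def R set_chi_def)
  have "(\<lambda>k. norm (f k - s k)) \<longlonglongrightarrow> 0"
  proof (rule residuals_tendsto_0[OF \<beta> f_step s_step])
    \<comment> \<open>From index 2 on, both \<open>f k\<close> and \<open>f (k - 1)\<close> are
      proximal points.\<close>
    show "f k \<in> C \<and> f (k - 1) \<in> C" if "2 \<le> k" for k
      using fC[of "k - 1"] fC[of "k - 2"] that by (simp add: numeral_2_eq_2 Suc_diff_Suc)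
    \<comment> \<open>The limit uses the lower bound 0, so it does not depend on the existence of a
      global minimum.\<close>
    show "0 \<le> \<D> x + ?r x" for x
      using \<D>_nonneg[of x] total_variation_nonneg[of \<tau> D x] \<open>\<tau> > 0\<close> by simp
  qed
  then have *: "(\<lambda>k. (1 + \<gamma> * L) / \<gamma> * norm (f (Suc k) - s (Suc k))) \<longlonglongrightarrow> 0"
    by (intro tendsto_mult_right_zero LIMSEQ_Suc)
  have "(\<lambda>k. norm (gradient_mapping \<gamma> \<D> \<R> (f (Suc k)))) \<longlonglongrightarrow> 0"
    by (rule tendsto_sandwich[OF _ _ tendsto_const *])
      (use gradient_mapping_bound[OF sU] in \<open>simp_all add: gm f_step\<close>)
  then have "(\<lambda>k. norm (gradient_mapping \<gamma> \<D> \<R> (f k))) \<longlonglongrightarrow> 0"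
    by (rule LIMSEQ_imp_Suc)
  moreover have "ereal (Min ((\<lambda>k. (norm (gradient_mapping \<gamma> \<D> \<R> (f k)))\<^sup>2) ` {1..K}))
         \<le> ereal (2 * L * (3 + \<gamma> * L)\<^sup>2) * (\<F> f0 - Fstar)
             / ereal (real K * \<gamma> * L * (1 - \<gamma> * L))"
    if ex: "\<exists>x. \<F> x = Fstar" and min: "\<And>x. Fstar \<le> \<F> x" and K: "0 < K" for Fstar K
  proof -
    have \<gamma>L: "\<gamma> * L < 1"
      by (rule relaxed_step_bound) fact+
    then have pos: "0 < real K * \<gamma> * L * (1 - \<gamma> * L)" "0 < 2 * L * (3 + \<gamma> * L)\<^sup>2"
      using K \<open>0 < \<gamma>\<close> \<open>0 < L\<close> by (simp_all add: add_pos_pos less_imp_neq[symmetric] flip: zero_less_power2)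
    \<comment> \<open>The minimum is finite: it is at most the finite value at a point of
      \<open>C\<close>, and it is attained, so it is a real value of the cost. Hence infinity minus
      \<open>Fstar\<close> is infinity in the case \<open>f0 \<notin> C\<close>.\<close>
    obtain b where b: "Fstar = ereal b"
    proof -
      obtain c where "c \<in> C" using \<open>C \<noteq> {}\<close> by auto
      moreover obtain x where "\<F> x = Fstar" using ex by auto
      ultimately show ?thesis
        using min[of c] F_C[of c] F_C[of x] F_notC[of x] that by (cases "x \<in> C") auto
    qed
    show ?thesis
    proof (cases "f0 \<in> C")
      case False
      have "ereal a \<le> ereal c * (\<infinity> - ereal b) / ereal d" if "0 < c" "0 < d" for a c d
        using that by simp
      from this[OF pos(2,1)] show ?thesis
        unfolding F_notC[OF False] b .
    next
      case True
      have lower: "b \<le> \<D> x + ?r x" if "x \<in> C" for x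
        using min[of x] F_C[OF that] b by simp
      have "Min ((\<lambda>k. (norm (gradient_mapping \<gamma> \<D> \<R> (f k)))\<^sup>2) ` {1..K})
          \<le> 2 * (1 + \<gamma> * L)\<^sup>2 * (\<D> f0 + ?r f0 - b) / (real K * \<gamma> * (1 - \<gamma> * L))"
        using Min_gradient_mapping_le[OF \<beta> f_step s_step _ lower K] True \<open>f 0 = f0\<close>
        by (simp add: gm)
      \<comment> \<open>The argument yields the smaller factor \<open>1 + \<gamma> * L\<close>;
        enlarging it is sound because \<open>\<D> f0 + ?r f0 - b\<close> is nonnegative.\<close>
      also have "\<dots> \<le> 2 * (3 + \<gamma> * L)\<^sup>2 * (\<D> f0 + ?r f0 - b) / (real K * \<gamma> * (1 - \<gamma> * L))"
        using lower[OF True] \<gamma>L \<open>0 < \<gamma>\<close> \<open>0 < L\<close>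
        by (intro divide_right_mono mult_right_mono mult_left_mono power_mono) auto
      also have "\<dots> = 2 * L * (3 + \<gamma> * L)\<^sup>2 * (\<D> f0 + ?r f0 - b)
          / (real K * \<gamma> * L * (1 - \<gamma> * L))"
        using \<open>0 < L\<close> by simp
      finally show ?thesis
        unfolding F_C[OF True] b using pos by (simp only: ereal_minus times_ereal.simps
            ereal_divide less_imp_neq[symmetric] if_False ereal_less_eq)
    qed
  qed
  ultimately show ?thesis by blast
qed

end
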